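(* Let $n,m$ be integers with $n\ge m\ge 1$, let $k\in\mathbb{Z}$ and $a\in\mathbb{C}$ with $a\neq0$. Then \begin{align*} &\sum_{l=0}^{n-m}\frac{\binom{n}{l}}{a^{n-l}}S_{1}(n-l,m)\,P\hat{C}_{l}^{(k)}(0:a)+\sum_{l=0}^{n-1-m}\frac{\binom{n-1}{l}}{a^{n-1-l}}S_{1}(n-1-l,m)\,P\hat{C}_{l}^{(k)}(0:a)\\ &=\left(1-\frac{1}{m}\right)\sum_{l=0}^{n-m}\frac{\binom{n-1}{l}}{a^{n-l}}S_{1}(n-1-l,m-1)\,P\hat{C}_{l}^{(k)}(-1:a)+\frac{1}{m}\sum_{l=0}^{n-m}\frac{\binom{n-1}{l}}{a^{n-l}}S_{1}(n-1-l,m-1)\,P\hat{C}_{l}^{(k-1)}(-1:a). \end{align*}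
   Context: For an integer $k$, $\mathrm{Lif}_k(t)=\sum_{n=0}^{\infty}\frac{t^{n}}{n!\,(n+1)^{k}}$. For $a\neq0$ and any integer $k$, the Poisson-Charlier and poly-Cauchy of the second kind mixed type polynomials $P\hat{C}_n^{(k)}(x:a)$ are defined by $e^{-t}\,\mathrm{Lif}_k\!\left(-\log\left(1+\frac{t}{a}\right)\right)\left(1+\frac{t}{a}\right)^{x}=\sum_{n\ge0}P\hat{C}_n^{(k)}(x:a)\frac{t^n}{n!}$. $S_1(n,l)$ denotes the (signed) Stirling numbers of the first kind, defined by $x(x-1)\cdots(x-n+1)=\sum_{l=0}^{n}S_1(n,l)x^l$. An empty sum is $0$. *)

theory Defs
  imports Complex_Main "HOL-Computational_Algebra.Computational_Algebra"
begin

text \<open>All generating functions are read as formal power series over the complex numbers.\<close>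

definition Lif :: "int \<Rightarrow> complex fps" where
  "Lif k = Abs_fps (\<lambda>n. 1 / (fact n * (of_nat n + 1) powi k))"

definition scaled_X :: "complex \<Rightarrow> complex fps" where
  "scaled_X a = fps_const (1 / a) * fps_X"

text \<open>
  In the library, \<^term>\<open>fps_ln 1\<close> is the series of \<open>log (1 + t)\<close> and \<^term>\<open>fps_binomial x\<close>
  that of \<open>(1 + t) ^ x\<close>, so the substitution of \<open>t / a\<close> is a composition.
\<close>

definition PC_hat_gf :: "int \<Rightarrow> complex \<Rightarrow> complex \<Rightarrow> complex fps" where
  "PC_hat_gf k x a =
     fps_exp (- 1) * (Lif k oo (- (fps_ln 1 oo scaled_X a))) * (fps_binomial x oo scaled_X a)"

definition PC_hat :: "int \<Rightarrow> nat \<Rightarrow> complex \<Rightarrow> complex \<Rightarrow> complex" where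
  "PC_hat k n x a = fact n * fps_nth (PC_hat_gf k x a) n"

lemma PC_hat_gf_eq: "PC_hat_gf k x a = Abs_fps (\<lambda>n. PC_hat k n x a / fact n)"
  by (simp add: PC_hat_def fps_eq_iff)

definition S1 :: "nat \<Rightarrow> nat \<Rightarrow> int" where
  "S1 n l = coeff (\<Prod>i<n. [:- int i, 1:]) l"

lemma S1_falling_factorial:
  fixes x :: int
  shows "(\<Prod>i<n. x - int i) = (\<Sum>l\<le>n. S1 n l * x ^ l)"
proof -
  have deg: "degree (\<Prod>i<n. [:- int i, 1:]) = n"
    by (subst degree_prod_eq_sum_degree) auto
  have "(\<Prod>i<n. x - int i) = poly (\<Prod>i<n. [:- int i, 1:]) x"
    by (simp add: poly_prod)
  also have "\<dots> = (\<Sum>l\<le>n. S1 n l * x ^ l)"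
    unfolding poly_altdef deg S1_def ..
  finally show ?thesis .
qed

end

theory Submission
  imports Defs
begin

text \<open>
  Put \<open>L = log (1 + t/a)\<close>. Since \<open>L\<^sup>m / m!\<close> is the exponential generating function of
  \<open>S\<^sub>1(n,m) / a\<^sup>n\<close>, the left-hand side is \<open>(n-1)!\<close> times the coefficient of \<open>t\<^sup>n\<^sup>-\<^sup>1\<close> in
  \<open>F' + F\<close>, where \<open>F = (L\<^sup>m / m!) G\<close> and \<open>G = e\<^sup>-\<^sup>t Lif\<^sub>k(-L) (1 + t/a)\<^sup>x\<close> with \<open>x = 0\<close>. The factor
  \<open>e\<^sup>-\<^sup>t\<close> contributes \<open>-F\<close> to \<open>F'\<close>, the derivative of \<open>Lif\<^sub>k(-L)\<close> is governed by
  \<open>u Lif\<^sub>k'(u) = Lif\<^sub>k\<^sub>-\<^sub>1(u) - Lif\<^sub>k(u)\<close> at \<open>u = -L\<close>, and \<open>L' = (1/a) (1 + t/a)\<^sup>-\<^sup>1\<close> shifts \<open>x\<close> to \<open>x - 1\<close>.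
\<close>

definition egf :: "(nat \<Rightarrow> 'a::field_char_0) \<Rightarrow> 'a fps" where
  "egf u = Abs_fps (\<lambda>n. u n / fact n)"

definition binomial_conv :: "(nat \<Rightarrow> 'a::comm_semiring_1) \<Rightarrow> (nat \<Rightarrow> 'a) \<Rightarrow> nat \<Rightarrow> 'a" where
  "binomial_conv u v n = (\<Sum>l\<le>n. of_nat (n choose l) * u (n - l) * v l)"

lemma egf_nth [simp]: "fps_nth (egf u) n = u n / fact n"
  by (simp add: egf_def)

lemma egf_mult: "egf u * egf v = egf (binomial_conv u v)"
proof (rule fps_ext)
  fix n
  have "fps_nth (egf v * egf u) n = (\<Sum>l\<le>n. v l / fact l * (u (n - l) / fact (n - l)))"
    by (simp add: fps_mult_nth atLeast0AtMost)
  also have "\<dots> = fps_nth (egf (binomial_conv u v)) n"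
    unfolding egf_nth binomial_conv_def sum_divide_distrib
    by (rule sum.cong) (simp_all add: binomial_fact)
  finally show "fps_nth (egf u * egf v) n = fps_nth (egf (binomial_conv u v)) n"
    by (simp only: mult.commute)
qed

lemma fps_deriv_egf: "fps_deriv (egf u) = egf (\<lambda>n. u (Suc n))"
  by (simp add: fps_eq_iff del: of_nat_Suc)

definition fps_divided_power :: "nat \<Rightarrow> 'a::field_char_0 fps \<Rightarrow> 'a fps" where
  "fps_divided_power m f = fps_const (1 / fact m) * f ^ m"

lemma fps_divided_power_0 [simp]: "fps_divided_power 0 f = 1"
  by (simp add: fps_divided_power_def)

lemma fps_divided_power_Suc:
  "fps_divided_power (Suc m) f = fps_const (1 / of_nat (Suc m)) * fps_divided_power m f * f"
proof -
  have "fps_const (1 / fact (Suc m)) =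
      (fps_const (1 / of_nat (Suc m)) * fps_const (1 / fact m) :: 'a fps)"
    by (simp del: of_nat_Suc)
  then show ?thesis
    by (simp add: fps_divided_power_def mult_ac del: fact_Suc fps_const_mult of_nat_Suc)
qed

lemma fps_deriv_divided_power_Suc:
  "fps_deriv (fps_divided_power (Suc m) f) = fps_divided_power m f * fps_deriv f"
proof -
  have "fps_const (1 / fact (Suc m)) * of_nat (Suc m) = (fps_const (1 / fact m) :: 'a fps)"
    by (simp add: fps_of_nat[symmetric] del: of_nat_Suc)
  moreover have "fps_deriv (fps_divided_power (Suc m) f) =
      (fps_const (1 / fact (Suc m)) * of_nat (Suc m)) * (f ^ m * fps_deriv f)"
    by (simp add: fps_divided_power_def fps_deriv_power' mult_ac
        del: of_nat_Suc power_Suc fact_Suc)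
  ultimately show ?thesis
    by (simp only: fps_divided_power_def mult.assoc)
qed

lemma fps_divided_power_compose:
  "fps_nth g 0 = 0 \<Longrightarrow> fps_divided_power m f oo g = fps_divided_power m (f oo g)"
  by (simp add: fps_divided_power_def fps_compose_power fps_compose_mult_distrib)

lemma S1_0_right: "S1 n 0 = (if n = 0 then 1 else 0)"
  by (induction n) (simp_all add: S1_def mult.commute[of _ "[:_, 1:]"])

lemma S1_Suc_Suc: "S1 (Suc n) (Suc m) = S1 n m - int n * S1 n (Suc m)"
  by (simp add: S1_def mult.commute[of _ "[:_, 1:]"])

lemma S1_eq_0:
  assumes "n < m"
  shows "S1 n m = 0"
proof -
  have "degree (\<Prod>i<n. [:- int i, 1:]) = n"
    by (subst degree_prod_eq_sum_degree) auto
  with assms show ?thesis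
    by (simp add: S1_def coeff_eq_0)
qed

lemma fps_divided_power_ln:
  "fps_divided_power m (fps_ln 1) = egf (\<lambda>n. of_int (S1 n m) :: 'a::field_char_0)"
proof (induction m)
  case 0
  show ?case by (auto simp: fps_eq_iff S1_0_right)
next
  case (Suc m)
  let ?E = "\<lambda>m. egf (\<lambda>n. of_int (S1 n m) :: 'a)"
  have recurrence: "(1 + fps_X) * fps_deriv (?E (Suc m)) = ?E m"
  proof -
    have "(1 + fps_X) * fps_deriv (?E (Suc m)) = fps_deriv (?E (Suc m)) + fps_XD (?E (Suc m))"
      by (simp add: fps_XD_def distrib_right)
    also have "\<dots> = ?E m"
      by (rule fps_ext)
         (simp add: fps_deriv_egf S1_Suc_Suc flip: add_divide_distrib)
    finally show ?thesis .
  qed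
  have "fps_deriv (?E (Suc m)) = inverse (1 + fps_X) * ((1 + fps_X) * fps_deriv (?E (Suc m)))"
    by (simp add: mult.assoc[symmetric] inverse_mult_eq_1)
  also have "\<dots> = fps_divided_power m (fps_ln 1) * fps_deriv (fps_ln 1)"
    by (simp add: recurrence Suc.IH fps_ln_deriv)
  also have "\<dots> = fps_deriv (fps_divided_power (Suc m) (fps_ln 1))"
    by (simp only: fps_deriv_divided_power_Suc)
  finally have "?E (Suc m) = fps_divided_power (Suc m) (fps_ln 1)"
    unfolding fps_deriv_eq_iff by (simp add: fps_divided_power_Suc S1_eq_0)
  then show ?case ..
qed

definition scaled_S1 :: "complex \<Rightarrow> nat \<Rightarrow> nat \<Rightarrow> complex" where
  "scaled_S1 a m n = of_int (S1 n m) / a ^ n"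

definition scaled_ln :: "complex \<Rightarrow> complex fps" where
  "scaled_ln a = fps_ln 1 oo scaled_X a"

definition scaled_binomial :: "complex \<Rightarrow> complex \<Rightarrow> complex fps" where
  "scaled_binomial x a = fps_binomial x oo scaled_X a"

lemma scaled_X_nth_0 [simp]: "fps_nth (scaled_X a) 0 = 0"
  by (simp add: scaled_X_def)

lemma fps_deriv_scaled_X [simp]: "fps_deriv (scaled_X a) = fps_const (1 / a)"
  by (simp add: scaled_X_def)

lemma egf_compose_scaled_X: "egf u oo scaled_X a = egf (\<lambda>n. u n / a ^ n)"
  by (simp add: scaled_X_def fps_compose_linear fps_eq_iff power_divide)

lemma scaled_ln_nth_0 [simp]: "fps_nth (scaled_ln a) 0 = 0"
  by (simp add: scaled_ln_def)

lemma fps_divided_power_scaled_ln: "fps_divided_power m (scaled_ln a) = egf (scaled_S1 a m)"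
proof -
  have "fps_divided_power m (scaled_ln a) = fps_divided_power m (fps_ln 1) oo scaled_X a"
    by (simp add: scaled_ln_def fps_divided_power_compose)
  then show ?thesis
    by (simp add: fps_divided_power_ln egf_compose_scaled_X scaled_S1_def[abs_def])
qed

lemma scaled_binomial_add: "scaled_binomial (x + y) a = scaled_binomial x a * scaled_binomial y a"
  by (simp add: scaled_binomial_def fps_binomial_add_mult fps_compose_mult_distrib)

lemma scaled_binomial_mult_minus_1:
  "scaled_binomial x a * scaled_binomial (- 1) a = scaled_binomial (x - 1) a"
  by (simp flip: scaled_binomial_add)

lemma fps_deriv_scaled_ln: "fps_deriv (scaled_ln a) = fps_const (1 / a) * scaled_binomial (- 1) a"
  by (simp add: scaled_ln_def scaled_binomial_def fps_compose_deriv fps_ln_deriv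
      fps_binomial_minus_one)

lemma fps_deriv_scaled_binomial:
  "fps_deriv (scaled_binomial x a) = fps_const (x / a) * scaled_binomial (x - 1) a"
proof -
  have "fps_deriv (fps_binomial x) = fps_const x * (fps_binomial x * fps_binomial (- 1))"
    by (simp add: fps_binomial_deriv fps_divide_unit fps_binomial_minus_one)
  also have "fps_binomial x * fps_binomial (- 1) = fps_binomial (x - 1)"
    by (simp flip: fps_binomial_add_mult)
  finally show ?thesis
    by (simp add: scaled_binomial_def fps_compose_deriv fps_compose_mult_distrib mult_ac
        flip: fps_const_mult)
qed

lemma fps_XD_Lif: "fps_XD (Lif k) = Lif (k - 1) - Lif k"
proof (rule fps_ext)
  fix n
  have "(of_nat n + 1 :: complex) \<noteq> 0"
    by (metis of_nat_Suc of_nat_neq_0 add.commute)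
  then show "fps_nth (fps_XD (Lif k)) n = fps_nth (Lif (k - 1) - Lif k) n"
    by (simp add: Lif_def power_int_diff diff_divide_distrib[symmetric])
qed

lemma mult_deriv_Lif_compose:
  assumes "fps_nth f 0 = 0"
  shows "f * (fps_deriv (Lif k) oo f) = (Lif (k - 1) oo f) - (Lif k oo f)"
proof -
  have "f * (fps_deriv (Lif k) oo f) = fps_XD (Lif k) oo f"
    using assms by (simp add: fps_XD_def fps_compose_mult_distrib)
  then show ?thesis
    by (simp add: fps_XD_Lif fps_compose_sub_distrib)
qed

lemma PC_hat_gf_altdef:
  "PC_hat_gf k x a = fps_exp (- 1) * (Lif k oo - scaled_ln a) * scaled_binomial x a"
  by (simp add: PC_hat_gf_def scaled_ln_def scaled_binomial_def)

lemma PC_hat_gf_eq_egf: "PC_hat_gf k x a = egf (\<lambda>l. PC_hat k l x a)"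
  by (simp add: PC_hat_gf_eq egf_def)

lemma deriv_scaled_ln_mult_PC_hat_gf:
  "fps_deriv (scaled_ln a) * PC_hat_gf k x a = fps_const (1 / a) * PC_hat_gf k (x - 1) a"
  by (simp add: fps_deriv_scaled_ln PC_hat_gf_altdef mult_ac flip: scaled_binomial_mult_minus_1)

lemma scaled_ln_mult_deriv_PC_hat_gf:
  "scaled_ln a * (fps_deriv (PC_hat_gf k x a) + PC_hat_gf k x a) =
    fps_const (1 / a) * (PC_hat_gf (k - 1) (x - 1) a - PC_hat_gf k (x - 1) a
      + fps_const x * (scaled_ln a * PC_hat_gf k (x - 1) a))"
proof -
  define L where "L = scaled_ln a"
  define E where "E = fps_exp (- 1 :: complex)"
  define P where "P = (\<lambda>k. Lif k oo - L)"
  define P' where "P' = fps_deriv (Lif k) oo - L"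
  define B where "B = (\<lambda>x. scaled_binomial x a)"
  define d where "d = fps_const (1 / a)"
  have deriv_E: "fps_deriv E = - E"
    by (simp add: E_def flip: fps_const_neg)
  have "fps_deriv (P k) = - (P' * fps_deriv L)"
    by (simp add: P_def P'_def L_def fps_compose_deriv)
  then have deriv_P: "fps_deriv (P k) * B x = - (d * P' * B (x - 1))"
    by (simp add: L_def B_def d_def fps_deriv_scaled_ln mult_ac
        flip: scaled_binomial_mult_minus_1)
  have deriv_B: "fps_deriv (B x) = d * fps_const x * B (x - 1)"
    by (simp add: B_def d_def fps_deriv_scaled_binomial)
  have L_mult_P': "- (L * P') = P (k - 1) - P k"
    using mult_deriv_Lif_compose[of "- L" k] by (simp add: P_def P'_def L_def)
  have gf: "PC_hat_gf k x a = E * P k * B x" for k x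
    by (simp add: PC_hat_gf_altdef E_def P_def B_def L_def)
  have "fps_deriv (E * P k * B x) + E * P k * B x =
      E * (fps_deriv (P k) * B x + P k * fps_deriv (B x))"
    by (simp add: deriv_E algebra_simps)
  also have "L * \<dots> = d * E * (- (L * P') + fps_const x * L * P k) * B (x - 1)"
    unfolding deriv_P deriv_B by (simp add: algebra_simps)
  also have "\<dots> = d * (E * P (k - 1) * B (x - 1) - E * P k * B (x - 1)
      + fps_const x * (L * (E * P k * B (x - 1))))"
    unfolding L_mult_P' by (simp add: algebra_simps)
  finally show ?thesis
    unfolding gf L_def d_def .
qed

lemma deriv_divided_power_scaled_ln_mult_PC_hat_gf:
  fixes a :: complex
  defines "D \<equiv> \<lambda>m. fps_divided_power m (scaled_ln a)"
  shows "fps_deriv (D (Suc m) * PC_hat_gf k x a) + D (Suc m) * PC_hat_gf k x a =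
    fps_const (1 / a) *
      (fps_const (1 - 1 / of_nat (Suc m)) * (D m * PC_hat_gf k (x - 1) a)
       + fps_const (1 / of_nat (Suc m)) * (D m * PC_hat_gf (k - 1) (x - 1) a)
       + fps_const x * (D (Suc m) * PC_hat_gf k (x - 1) a))"
proof -
  define L where "L = scaled_ln a"
  define G where "G = PC_hat_gf k x a"
  define G_shift where "G_shift = (\<lambda>k. PC_hat_gf k (x - 1) a)"
  define c where "c = fps_const (1 / of_nat (Suc m) :: complex)"
  define d where "d = fps_const (1 / a)"
  have D_Suc: "D (Suc m) = c * D m * L"
    by (simp add: D_def c_def L_def fps_divided_power_Suc)
  have deriv_D_Suc: "fps_deriv (D (Suc m)) = D m * fps_deriv L"
    by (simp only: D_def L_def fps_deriv_divided_power_Suc)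
  have "fps_deriv (D (Suc m) * G) + D (Suc m) * G =
      fps_deriv (D (Suc m)) * G + D (Suc m) * (fps_deriv G + G)"
    by (simp add: algebra_simps)
  also have "\<dots> = D m * (fps_deriv L * G) + c * D m * (L * (fps_deriv G + G))"
    unfolding deriv_D_Suc unfolding D_Suc by (simp only: mult.assoc)
  also have "\<dots> = D m * (d * G_shift k)
      + c * D m * (d * (G_shift (k - 1) - G_shift k + fps_const x * (L * G_shift k)))"
    unfolding L_def G_def G_shift_def d_def
    by (simp only: deriv_scaled_ln_mult_PC_hat_gf scaled_ln_mult_deriv_PC_hat_gf)
  also have "\<dots> = d * ((1 - c) * (D m * G_shift k) + c * (D m * G_shift (k - 1))
      + fps_const x * (D (Suc m) * G_shift k))"
    by (simp add: D_Suc algebra_simps)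
  also have "1 - c = fps_const (1 - 1 / of_nat (Suc m))"
    unfolding c_def fps_const_1_eq_1[symmetric] fps_const_sub ..
  finally show ?thesis
    unfolding G_def G_shift_def c_def d_def .
qed

lemma binomial_conv_scaled_S1_PC_hat_Suc:
  fixes a :: complex
  defines "T \<equiv> \<lambda>m k x. binomial_conv (scaled_S1 a m) (\<lambda>l. PC_hat k l x a)"
  shows "T (Suc m) k x (Suc n) + T (Suc m) k x n =
    ((1 - 1 / of_nat (Suc m)) * T m k (x - 1) n
      + 1 / of_nat (Suc m) * T m (k - 1) (x - 1) n + x * T (Suc m) k (x - 1) n) / a"
proof -
  have gf: "fps_divided_power m (scaled_ln a) * PC_hat_gf k x a = egf (T m k x)" for m k x
    by (simp add: fps_divided_power_scaled_ln PC_hat_gf_eq_egf egf_mult T_def)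
  have "(T (Suc m) k x (Suc n) + T (Suc m) k x n) / fact n =
      fps_nth (fps_deriv (egf (T (Suc m) k x)) + egf (T (Suc m) k x)) n"
    by (simp add: fps_deriv_egf add_divide_distrib)
  also have "\<dots> = ((1 - 1 / of_nat (Suc m)) * T m k (x - 1) n
      + 1 / of_nat (Suc m) * T m (k - 1) (x - 1) n + x * T (Suc m) k (x - 1) n) / a / fact n"
    unfolding gf[symmetric] deriv_divided_power_scaled_ln_mult_PC_hat_gf
    unfolding gf by (simp add: add_divide_distrib distrib_left del: of_nat_Suc)
  finally show ?thesis
    by (simp only: divide_cancel_right fact_nonzero simp_thms)
qed

lemma sum_S1_eq_binomial_conv:
  assumes "A \<subseteq> {..n}" and "\<And>l. l + m \<le> n \<Longrightarrow> l \<in> A"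
  shows "(\<Sum>l\<in>A. of_nat (n choose l) / a ^ (n - l) * of_int (S1 (n - l) m) * v l) =
    binomial_conv (scaled_S1 a m) v n"
  unfolding binomial_conv_def
proof (rule sum.mono_neutral_cong_left)
  show "\<forall>l\<in>{..n} - A. of_nat (n choose l) * scaled_S1 a m (n - l) * v l = 0"
  proof
    fix l assume "l \<in> {..n} - A"
    with assms(2)[of l] have "n - l < m" by force
    then show "of_nat (n choose l) * scaled_S1 a m (n - l) * v l = 0"
      by (simp add: scaled_S1_def S1_eq_0)
  qed
qed (use assms(1) in \<open>auto simp: scaled_S1_def\<close>)

lemma sum_S1_Suc_power_eq_binomial_conv:
  "(\<Sum>l=0..n-m. of_nat (n choose l) / a ^ (Suc n - l) * of_int (S1 (n - l) m) * v l) =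
    binomial_conv (scaled_S1 a m) v n / a"
proof -
  have "(\<Sum>l=0..n-m. of_nat (n choose l) / a ^ (Suc n - l) * of_int (S1 (n - l) m) * v l) =
      (\<Sum>l=0..n-m. of_nat (n choose l) / a ^ (n - l) * of_int (S1 (n - l) m) * v l) / a"
    unfolding sum_divide_distrib by (rule sum.cong) (auto simp: Suc_diff_le)
  also have "\<dots> = binomial_conv (scaled_S1 a m) v n / a"
    by (subst sum_S1_eq_binomial_conv) auto
  finally show ?thesis .
qed

theorem theorem7:
  fixes n m :: nat and k :: int and a :: complex
  assumes "m \<ge> 1" and "n \<ge> m" and "a \<noteq> 0"
  shows "(\<Sum>l=0..n-m. of_nat (n choose l) / a ^ (n-l) * of_int (S1 (n-l) m) * PC_hat k l 0 a)
       + (\<Sum>l=0..<n-m. of_nat ((n-1) choose l) / a ^ (n-1-l) * of_int (S1 (n-1-l) m) * PC_hat k l 0 a)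
       = (1 - 1 / of_nat m) *
           (\<Sum>l=0..n-m. of_nat ((n-1) choose l) / a ^ (n-l) * of_int (S1 (n-1-l) (m-1)) * PC_hat k l (-1) a)
       + 1 / of_nat m *
           (\<Sum>l=0..n-m. of_nat ((n-1) choose l) / a ^ (n-l) * of_int (S1 (n-1-l) (m-1)) * PC_hat (k-1) l (-1) a)"
proof -
  obtain j where m: "m = Suc j" using assms(1) by (cases m) auto
  obtain N where n: "n = Suc N" using assms(1,2) by (cases n) auto
  define T where "T = (\<lambda>m k x. binomial_conv (scaled_S1 a m) (\<lambda>l. PC_hat k l x a))"
  have "(\<Sum>l=0..n-m. of_nat (n choose l) / a ^ (n-l) * of_int (S1 (n-l) m) * PC_hat k l 0 a) =
      T m k 0 n"
    unfolding T_def by (rule sum_S1_eq_binomial_conv) auto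
  moreover have "(\<Sum>l=0..<n-m. of_nat ((n-1) choose l) / a ^ (n-1-l) * of_int (S1 (n-1-l) m)
      * PC_hat k l 0 a) = T m k 0 N"
    unfolding T_def n diff_Suc_1 by (rule sum_S1_eq_binomial_conv) (auto simp: m)
  moreover have "(\<Sum>l=0..n-m. of_nat ((n-1) choose l) / a ^ (n-l) * of_int (S1 (n-1-l) (m-1))
      * PC_hat k' l (-1) a) = T j k' (-1) N / a" for k'
    unfolding T_def m n diff_Suc_1 diff_Suc_Suc by (rule sum_S1_Suc_power_eq_binomial_conv)
  moreover have "T m k 0 n + T m k 0 N =
      (1 - 1 / of_nat m) * (T j k (-1) N / a) + 1 / of_nat m * (T j (k - 1) (-1) N / a)"
    unfolding T_def m n binomial_conv_scaled_S1_PC_hat_Suc by (simp add: add_divide_distrib)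
  ultimately show ?thesis
    by simp
qed

end
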